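(* Let $L$ be a bounded distributive lattice. The Priestley space $P(L^\Box)$ is order-homeomorphic to $\mathcal{F}(L)$, and thus dually order-homeomorphic to $\mathcal{F}_-^{\Diamond\Box}$. The spectral space $P^+(L^\Box)$ is homeomorphic to $\mathcal{F}_-^{\Box}$, and the spectral space $P^-(L^\Box)$ is homeomorphic to $\mathcal{F}_-^{\Diamond}$.
   Context: For a bounded distributive lattice $D$, its Priestley space is $P(D)=(X_D,\pi_D,\leq)$, where $X_D$ is the set of (proper) prime filters of $D$, $\leq$ is inclusion, and $\pi_D$ is generated by the sets $a^+=\{x\in X_D\mid a\in x\}$ and $a^-=\{x\in X_D\mid a\notin x\}$, $a\in D$. $P^+(D)$ is $X_D$ with the topology $\pi_D^+$ of $\pi_D$-open upsets, and $P^-(D)$ is $X_D$ with the topology $\pi_D^-$ of $\pi_D$-open downsets; both are spectral spaces. $L^\Box$ is the bounded distributive lattice freely generated by symbols $\Box_a$, $a\in L$, modulo the relations $\Box_1=1$ and $\Box_{a\wedge b}=\Box_a\wedge\Box_b$ for all $a,b\in L$. $\mathcal{F}(L)$ is the set of filters of $L$ (nonempty, possibly improper) ordered by inclusion, with the topology generated by the sets $\{F\mid a\in F\}$ and $\{F\mid a\notin F\}$ for $a\in L$; it is a Priestley space. Write $P(L)=(X,\pi,\leq)$. $\mathcal{F}_-$ is the set of closed sets of $(X,\pi^-)$, i.e. the $\pi$-closed upsets of $X$ (including $\varnothing$), ordered by inclusion. For $U$ open and $K$ compact in $(X,\pi^-)$ let $\Diamond_U=\{C\in\mathcal{F}_-\mid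 C\cap U\neq\varnothing\}$ and $\Box_K=\{C\in\mathcal{F}_-\mid C\cap K=\varnothing\}$. $\mathcal{F}_-^\Diamond$, $\mathcal{F}_-^\Box$ denote $\mathcal{F}_-$ with the topology generated by all $\Diamond_U$, respectively by all $\Box_K$; $\mathcal{F}_-^{\Diamond\Box}$ is $\mathcal{F}_-$ with the join of these topologies and the inclusion order. An order-homeomorphism is a homeomorphism that is an order-isomorphism; a dual order-homeomorphism is a homeomorphism that is an order-reversing isomorphism. *)

theory Defs
  imports "HOL-Analysis.Analysis"
begin

section \<open>The free lattice \<open>L\<^sup>\<box>\<close>\<close>

datatype 'a box_term =
    Gen 'a
  | Zero
  | One
  | Meet "'a box_term" "'a box_term"
  | Join "'a box_term" "'a box_term"

text \<open>The least congruence on terms containing the axioms of bounded distributive lattices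
  and the two defining relations \<open>gen_top\<close> and \<open>gen_inf\<close>.\<close>

inductive box_eq :: "'a::{distrib_lattice,bounded_lattice} box_term \<Rightarrow> 'a box_term \<Rightarrow> bool" where
  gen_top: "box_eq (Gen top) One"
| gen_inf: "box_eq (Gen (inf a b)) (Meet (Gen a) (Gen b))"
| refl: "box_eq s s"
| sym: "box_eq s t \<Longrightarrow> box_eq t s"
| trans: "box_eq s t \<Longrightarrow> box_eq t u \<Longrightarrow> box_eq s u"
| meet_cong: "box_eq s s' \<Longrightarrow> box_eq t t' \<Longrightarrow> box_eq (Meet s t) (Meet s' t')"
| join_cong: "box_eq s s' \<Longrightarrow> box_eq t t' \<Longrightarrow> box_eq (Join s t) (Join s' t')"
| meet_assoc: "box_eq (Meet (Meet s t) u) (Meet s (Meet t u))"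
| join_assoc: "box_eq (Join (Join s t) u) (Join s (Join t u))"
| meet_comm: "box_eq (Meet s t) (Meet t s)"
| join_comm: "box_eq (Join s t) (Join t s)"
| meet_absorb: "box_eq (Meet s (Join s t)) s"
| join_absorb: "box_eq (Join s (Meet s t)) s"
| distrib: "box_eq (Join s (Meet t u)) (Meet (Join s t) (Join s u))"
| meet_one: "box_eq (Meet s One) s"
| join_zero: "box_eq (Join s Zero) s"

quotient_type (overloaded) 'a free_box =
  "'a::{distrib_lattice,bounded_lattice} box_term" / box_eq
  by (intro equivpI reflpI sympI transpI) (blast intro: box_eq.intros)+

lift_definition box_gen :: "'a::{distrib_lattice,bounded_lattice} \<Rightarrow> 'a free_box" is Gen .

instantiation free_box :: ("{distrib_lattice,bounded_lattice}") "{distrib_lattice,bounded_lattice}"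
begin

lift_definition inf_free_box :: "'a free_box \<Rightarrow> 'a free_box \<Rightarrow> 'a free_box" is Meet
  by (rule box_eq.meet_cong)

lift_definition sup_free_box :: "'a free_box \<Rightarrow> 'a free_box \<Rightarrow> 'a free_box" is Join
  by (rule box_eq.join_cong)

lift_definition bot_free_box :: "'a free_box" is Zero .

lift_definition top_free_box :: "'a free_box" is One .

definition less_eq_free_box :: "'a free_box \<Rightarrow> 'a free_box \<Rightarrow> bool" where
  "less_eq_free_box x y \<longleftrightarrow> inf x y = x"

definition less_free_box :: "'a free_box \<Rightarrow> 'a free_box \<Rightarrow> bool" where
  "less_free_box x y \<longleftrightarrow> less_eq x y \<and> x \<noteq> y"

instance
proof
  have ma: "inf (inf x y) z = inf x (inf y z)" for x y z :: "'a free_box"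
    by transfer (rule box_eq.meet_assoc)
  have ja: "sup (sup x y) z = sup x (sup y z)" for x y z :: "'a free_box"
    by transfer (rule box_eq.join_assoc)
  have mc: "inf x y = inf y x" for x y :: "'a free_box"
    by transfer (rule box_eq.meet_comm)
  have jc: "sup x y = sup y x" for x y :: "'a free_box"
    by transfer (rule box_eq.join_comm)
  have mabs: "inf x (sup x y) = x" for x y :: "'a free_box"
    by transfer (rule box_eq.meet_absorb)
  have jabs: "sup x (inf x y) = x" for x y :: "'a free_box"
    by transfer (rule box_eq.join_absorb)
  have mi: "inf x x = x" for x :: "'a free_box"
    by (metis mabs jabs)
  have le_sup: "x \<le> y \<longleftrightarrow> sup x y = y" for x y :: "'a free_box"
    unfolding less_eq_free_box_def by (metis mabs jabs mc jc)
  fix x y z :: "'a free_box"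
  show "x \<le> x" by (simp add: less_eq_free_box_def mi)
  show "x \<le> z" if "x \<le> y" "y \<le> z"
    using that unfolding less_eq_free_box_def by (metis ma)
  show "x = y" if "x \<le> y" "y \<le> x"
    using that unfolding less_eq_free_box_def by (metis mc)
  show "x < y \<longleftrightarrow> x \<le> y \<and> \<not> y \<le> x"
    unfolding less_free_box_def less_eq_free_box_def by (metis mc mi)
  show "inf x y \<le> x" unfolding less_eq_free_box_def by (metis ma mc mi)
  show "inf x y \<le> y" unfolding less_eq_free_box_def by (metis ma mi)
  show "x \<le> inf y z" if "x \<le> y" "x \<le> z"
    using that unfolding less_eq_free_box_def by (metis ma)
  show "x \<le> sup x y" unfolding less_eq_free_box_def by (rule mabs)
  show "y \<le> sup x y" unfolding less_eq_free_box_def by (metis mabs jc)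
  show "sup y z \<le> x" if "y \<le> x" "z \<le> x"
    using that unfolding le_sup by (metis ja)
  show "bot \<le> x" unfolding le_sup jc[of bot] by transfer (rule box_eq.join_zero)
  show "x \<le> top" unfolding less_eq_free_box_def by transfer (rule box_eq.meet_one)
  show "sup x (inf y z) = inf (sup x y) (sup x z)" by transfer (rule box_eq.distrib)
qed

end

lemma box_gen_top: "box_gen top = top"
  by transfer (rule box_eq.gen_top)

lemma box_gen_inf: "box_gen (inf a b) = inf (box_gen a) (box_gen b)"
  by transfer (rule box_eq.gen_inf)

definition bounded_lattice_hom :: "('a::bounded_lattice \<Rightarrow> 'b::bounded_lattice) \<Rightarrow> bool" where
  "bounded_lattice_hom f \<longleftrightarrow> f bot = bot \<and> f top = top \<and>
     (\<forall>x y. f (inf x y) = inf (f x) (f y)) \<and> (\<forall>x y. f (sup x y) = sup (f x) (f y))"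

primrec eval_box_term ::
  "('a \<Rightarrow> 'b::{distrib_lattice,bounded_lattice}) \<Rightarrow> 'a box_term \<Rightarrow> 'b" where
  "eval_box_term h (Gen a) = h a"
| "eval_box_term h Zero = bot"
| "eval_box_term h One = top"
| "eval_box_term h (Meet s t) = inf (eval_box_term h s) (eval_box_term h t)"
| "eval_box_term h (Join s t) = sup (eval_box_term h s) (eval_box_term h t)"

text \<open>The universal property, confirming that \<^typ>\<open>'a free_box\<close> is the lattice presented by
  the generators \<^const>\<open>box_gen\<close> and the relations \<open>gen_top\<close>, \<open>gen_inf\<close>.\<close>

theorem free_box_universal:
  fixes h :: "'a::{distrib_lattice,bounded_lattice} \<Rightarrow> 'b::{distrib_lattice,bounded_lattice}"
  assumes "h top = top" and "\<And>a b. h (inf a b) = inf (h a) (h b)"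
  shows "\<exists>!f. bounded_lattice_hom f \<and> (\<forall>a. f (box_gen a) = h a)"
proof -
  have eval_eq: "eval_box_term h s = eval_box_term h t" if "box_eq s t" for s t
    using that
    by induction (simp_all add: assms ac_simps sup_inf_distrib1
        inf_sup_absorb sup_inf_absorb)
  define e where "e = (\<lambda>x. eval_box_term h (rep_free_box x))"
  have e_abs: "e (abs_free_box t) = eval_box_term h t" for t
    unfolding e_def
    by (rule eval_eq) (rule Quotient_rep_abs[OF Quotient_free_box box_eq.refl])
  have e_hom: "bounded_lattice_hom e"
    unfolding bounded_lattice_hom_def
  proof (intro conjI allI)
    show "e bot = bot" by (simp add: bot_free_box_def e_abs)
    show "e top = top" by (simp add: top_free_box_def e_abs)
    fix x y :: "'a free_box"
    obtain s t where [simp]: "x = abs_free_box s" "y = abs_free_box t"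
      by (metis Quotient_free_box Quotient_abs_rep)
    show "e (inf x y) = inf (e x) (e y)"
      by (simp add: inf_free_box.abs_eq e_abs)
    show "e (sup x y) = sup (e x) (e y)"
      by (simp add: sup_free_box.abs_eq e_abs)
  qed
  have e_gen: "e (box_gen a) = h a" for a
    by (simp add: box_gen.abs_eq e_abs)
  have unique: "f = e" if f: "bounded_lattice_hom f" "\<forall>a. f (box_gen a) = h a" for f
  proof
    have *: "f (abs_free_box t) = eval_box_term h t" for t
      using f unfolding bounded_lattice_hom_def
      by (induction t)
        (auto simp: box_gen.abs_eq bot_free_box_def top_free_box_def
          simp flip: inf_free_box.abs_eq sup_free_box.abs_eq)
    fix x
    show "f x = e x"
      by (metis * e_abs Quotient_free_box Quotient_abs_rep)
  qed
  show ?thesis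
    using e_hom e_gen unique by blast
qed


section \<open>Priestley spaces\<close>

definition lattice_filter :: "'a::bounded_lattice set \<Rightarrow> bool" where
  "lattice_filter F \<longleftrightarrow> F \<noteq> {} \<and> (\<forall>a b. a \<in> F \<longrightarrow> a \<le> b \<longrightarrow> b \<in> F) \<and>
     (\<forall>a b. a \<in> F \<longrightarrow> b \<in> F \<longrightarrow> inf a b \<in> F)"

definition prime_filter :: "'a::bounded_lattice set \<Rightarrow> bool" where
  "prime_filter F \<longleftrightarrow> lattice_filter F \<and> F \<noteq> UNIV \<and>
     (\<forall>a b. sup a b \<in> F \<longrightarrow> a \<in> F \<or> b \<in> F)"

text \<open>A topological space of subsets carries the inclusion order of its points.\<close>

definition priestley_space :: "'a::{distrib_lattice,bounded_lattice} set topology" where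
  "priestley_space = topology_generated_by
     (range (\<lambda>a. {x. prime_filter x \<and> a \<in> x}) \<union> range (\<lambda>a. {x. prime_filter x \<and> a \<notin> x}))"

lemma topspace_priestley_space: "topspace priestley_space = {x. prime_filter x}"
  unfolding priestley_space_def topology_generated_by_topspace by blast

definition upset_in :: "'a::order set \<Rightarrow> 'a set \<Rightarrow> bool" where
  "upset_in X U \<longleftrightarrow> U \<subseteq> X \<and> (\<forall>x\<in>U. \<forall>y\<in>X. x \<le> y \<longrightarrow> y \<in> U)"

definition downset_in :: "'a::order set \<Rightarrow> 'a set \<Rightarrow> bool" where
  "downset_in X U \<longleftrightarrow> U \<subseteq> X \<and> (\<forall>x\<in>U. \<forall>y\<in>X. y \<le> x \<longrightarrow> y \<in> U)"

definition upset_topology :: "'a::order topology \<Rightarrow> 'a topology" where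
  "upset_topology T = topology (\<lambda>U. openin T U \<and> upset_in (topspace T) U)"

definition downset_topology :: "'a::order topology \<Rightarrow> 'a topology" where
  "downset_topology T = topology (\<lambda>U. openin T U \<and> downset_in (topspace T) U)"

lemma openin_upset_topology:
  "openin (upset_topology T) U \<longleftrightarrow> openin T U \<and> upset_in (topspace T) U"
proof -
  have "istopology (\<lambda>U. openin T U \<and> upset_in (topspace T) U)"
    unfolding istopology_def
  proof (intro conjI allI impI)
    fix U V
    assume "openin T U \<and> upset_in (topspace T) U" "openin T V \<and> upset_in (topspace T) V"
    then show "openin T (U \<inter> V)" "upset_in (topspace T) (U \<inter> V)"
      by (auto simp: upset_in_def)
  next
    fix \<K>
    assume "\<forall>K\<in>\<K>. openin T K \<and> upset_in (topspace T) K"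
    then show "openin T (\<Union>\<K>)" "upset_in (topspace T) (\<Union>\<K>)"
      unfolding upset_in_def by (blast intro: openin_Union)+
  qed
  then show ?thesis
    unfolding upset_topology_def by (simp add: topology_inverse')
qed

lemma topspace_upset_topology: "topspace (upset_topology T) = topspace T"
proof (rule subset_antisym)
  show "topspace (upset_topology T) \<subseteq> topspace T"
    using openin_topspace[of "upset_topology T"]
    unfolding openin_upset_topology upset_in_def by blast
  show "topspace T \<subseteq> topspace (upset_topology T)"
    by (rule openin_subset) (simp add: openin_upset_topology upset_in_def)
qed

lemma openin_downset_topology:
  "openin (downset_topology T) U \<longleftrightarrow> openin T U \<and> downset_in (topspace T) U"
proof -
  have "istopology (\<lambda>U. openin T U \<and> downset_in (topspace T) U)"
    unfolding istopology_def
  proof (intro conjI allI impI)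
    fix U V
    assume "openin T U \<and> downset_in (topspace T) U" "openin T V \<and> downset_in (topspace T) V"
    then show "openin T (U \<inter> V)" "downset_in (topspace T) (U \<inter> V)"
      by (auto simp: downset_in_def)
  next
    fix \<K>
    assume "\<forall>K\<in>\<K>. openin T K \<and> downset_in (topspace T) K"
    then show "openin T (\<Union>\<K>)" "downset_in (topspace T) (\<Union>\<K>)"
      unfolding downset_in_def by (blast intro: openin_Union)+
  qed
  then show ?thesis
    unfolding downset_topology_def by (simp add: topology_inverse')
qed

lemma topspace_downset_topology: "topspace (downset_topology T) = topspace T"
proof (rule subset_antisym)
  show "topspace (downset_topology T) \<subseteq> topspace T"
    using openin_topspace[of "downset_topology T"]
    unfolding openin_downset_topology downset_in_def by blast
  show "topspace T \<subseteq> topspace (downset_topology T)"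
    by (rule openin_subset) (simp add: openin_downset_topology downset_in_def)
qed

definition priestley_plus :: "'a::{distrib_lattice,bounded_lattice} set topology" where
  "priestley_plus = upset_topology priestley_space"

definition priestley_minus :: "'a::{distrib_lattice,bounded_lattice} set topology" where
  "priestley_minus = downset_topology priestley_space"

lemma topspace_priestley_plus: "topspace priestley_plus = {x. prime_filter x}"
  by (simp add: priestley_plus_def topspace_upset_topology topspace_priestley_space)

lemma topspace_priestley_minus: "topspace priestley_minus = {x. prime_filter x}"
  by (simp add: priestley_minus_def topspace_downset_topology topspace_priestley_space)


section \<open>The space of filters and the hyperspaces of closed sets\<close>

definition filter_space :: "'a::{distrib_lattice,bounded_lattice} set topology" where
  "filter_space = topology_generated_by
     (range (\<lambda>a. {F. lattice_filter F \<and> a \<in> F}) \<union> range (\<lambda>a. {F. lattice_filter F \<and> a \<notin> F}))"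

lemma topspace_filter_space: "topspace filter_space = {F. lattice_filter F}"
  unfolding filter_space_def topology_generated_by_topspace by blast

definition hyper_minus :: "'a::{distrib_lattice,bounded_lattice} set set set" where
  "hyper_minus = {C. closedin priestley_minus C}"

definition diamond_set :: "'a::{distrib_lattice,bounded_lattice} set set \<Rightarrow> 'a set set set" where
  "diamond_set U = {C \<in> hyper_minus. C \<inter> U \<noteq> {}}"

definition box_set :: "'a::{distrib_lattice,bounded_lattice} set set \<Rightarrow> 'a set set set" where
  "box_set K = {C \<in> hyper_minus. C \<inter> K = {}}"

text \<open>No \<^const>\<open>diamond_set\<close> contains the point \<^term>\<open>{}\<close>. As the underlying set of
  \<^const>\<open>topology_generated_by\<close> is the union of the given subbase, the whole hyperspace has
  to be added to the subbase explicitly.\<close>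

definition hyper_diamond :: "'a::{distrib_lattice,bounded_lattice} set set topology" where
  "hyper_diamond = topology_generated_by
     (insert hyper_minus {diamond_set U |U. openin priestley_minus U})"

definition hyper_box :: "'a::{distrib_lattice,bounded_lattice} set set topology" where
  "hyper_box = topology_generated_by
     (insert hyper_minus {box_set K |K. compactin priestley_minus K})"

definition hyper_diamond_box :: "'a::{distrib_lattice,bounded_lattice} set set topology" where
  "hyper_diamond_box = topology_generated_by
     ({W. openin hyper_diamond W} \<union> {W. openin hyper_box W})"

lemma topspace_hyper_diamond: "topspace hyper_diamond = hyper_minus"
  unfolding hyper_diamond_def topology_generated_by_topspace diamond_set_def by blast

lemma topspace_hyper_box: "topspace hyper_box = hyper_minus"
  unfolding hyper_box_def topology_generated_by_topspace box_set_def by blast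

lemma topspace_hyper_diamond_box: "topspace hyper_diamond_box = hyper_minus"
proof -
  have "\<Union> {W. openin hyper_diamond W} = hyper_minus" "\<Union> {W. openin hyper_box W} = hyper_minus"
    by (simp_all flip: topspace_def add: topspace_hyper_diamond topspace_hyper_box)
  then show ?thesis
    unfolding hyper_diamond_box_def topology_generated_by_topspace by auto
qed


section \<open>Order-homeomorphisms\<close>

definition order_homeomorphism ::
  "'a::order topology \<Rightarrow> 'b::order topology \<Rightarrow> ('a \<Rightarrow> 'b) \<Rightarrow> bool" where
  "order_homeomorphism S T f \<longleftrightarrow> homeomorphic_map S T f \<and>
     (\<forall>x\<in>topspace S. \<forall>y\<in>topspace S. x \<le> y \<longleftrightarrow> f x \<le> f y)"

definition dual_order_homeomorphism ::
  "'a::order topology \<Rightarrow> 'b::order topology \<Rightarrow> ('a \<Rightarrow> 'b) \<Rightarrow> bool" where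
  "dual_order_homeomorphism S T f \<longleftrightarrow> homeomorphic_map S T f \<and>
     (\<forall>x\<in>topspace S. \<forall>y\<in>topspace S. x \<le> y \<longleftrightarrow> f y \<le> f x)"

definition order_homeomorphic :: "'a::order topology \<Rightarrow> 'b::order topology \<Rightarrow> bool" where
  "order_homeomorphic S T \<longleftrightarrow> (\<exists>f. order_homeomorphism S T f)"

definition dually_order_homeomorphic :: "'a::order topology \<Rightarrow> 'b::order topology \<Rightarrow> bool" where
  "dually_order_homeomorphic S T \<longleftrightarrow> (\<exists>f. dual_order_homeomorphism S T f)"

end

theory Submission
  imports Defs
begin

text \<open>A prime filter \<open>x\<close> of \<open>L\<^sup>\<box>\<close> is determined by its trace \<open>{a. \<box>\<^sub>a \<in> x}\<close>, a filter of \<open>L\<close>; every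
  filter \<open>F\<close> arises in this way, because its characteristic function into the two-element lattice
  preserves \<open>\<top>\<close> and \<open>\<and>\<close> and so extends to \<open>L\<^sup>\<box>\<close>. By the prime filter theorem a filter \<open>F\<close>
  amounts to the closed set of all prime filters above \<open>F\<close>. Under these two bijections the sets
  \<open>(\<box>\<^sub>a)\<^sup>+\<close>, \<open>{F. a \<in> F}\<close>, and the box set of \<open>a\<^sup>-\<close> correspond to each other, and so do \<open>(\<box>\<^sub>a)\<^sup>-\<close>,
  \<open>{F. a \<notin> F}\<close>, and the diamond set of \<open>a\<^sup>-\<close>. By compactness of Priestley spaces, these
  sets form subbases of the topologies in question.\<close>

section \<open>Generated topologies\<close>

lemma openin_generated_minimal:
  assumes "openin (topology_generated_by \<S>) W" "\<And>U. U \<in> \<S> \<Longrightarrow> openin T U"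
  shows "openin T W"
  using generate_topology_on_coarsest[of "openin T" \<S> W] assms
  by (simp add: openin_topology_generated_by_iff)

lemma topology_generated_by_eqI:
  assumes "\<And>U. U \<in> \<S> \<Longrightarrow> openin (topology_generated_by \<T>) U"
    and "\<And>U. U \<in> \<T> \<Longrightarrow> openin (topology_generated_by \<S>) U"
  shows "topology_generated_by \<S> = topology_generated_by \<T>"
  unfolding topology_eq using assms openin_generated_minimal by blast

lemma continuous_map_generated:
  assumes "f ` \<Union>\<S> \<subseteq> \<Union>\<T>" "\<And>U. U \<in> \<T> \<Longrightarrow> f -` U \<inter> \<Union>\<S> \<in> \<S>"
  shows "continuous_map (topology_generated_by \<S>) (topology_generated_by \<T>) f"
  unfolding continuous_on_generated_topo_iff
  using assms by (simp add: topology_generated_by_Basis)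

text \<open>An injection that carries one subbase onto the other, set by set, is continuous in both
  directions: preimages under the map and under its inverse are again subbasic. All four
  homeomorphisms come from this, so the remaining work is to find matching subbases.\<close>

lemma homeomorphic_map_generated:
  assumes inj: "inj_on f (\<Union>\<S>)" and img: "(`) f ` \<S> = \<T>"
  shows "homeomorphic_map (topology_generated_by \<S>) (topology_generated_by \<T>) f"
proof -
  let ?g = "inv_into (\<Union>\<S>) f"
  have UT: "\<Union>\<T> = f ` \<Union>\<S>"
    using img by blast
  have pre: "f -` f ` V \<inter> \<Union>\<S> = V" if "V \<in> \<S>" for V
  proof
    show "f -` f ` V \<inter> \<Union>\<S> \<subseteq> V"
      using that inj unfolding inj_on_def by blast
  qed (use that in blast)
  have gf: "?g (f x) = x" if "x \<in> \<Union>\<S>" for x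
    using that by (rule inv_into_f_f[OF inj])
  have gpre: "?g -` V \<inter> \<Union>\<T> = f ` V" if "V \<in> \<S>" for V
  proof -
    have "V \<subseteq> \<Union>\<S>" using that by blast
    then show ?thesis unfolding UT using gf by (force simp del: Union_iff)
  qed
  have "continuous_map (topology_generated_by \<S>) (topology_generated_by \<T>) f"
  proof (rule continuous_map_generated)
    show "f -` U \<inter> \<Union>\<S> \<in> \<S>" if U: "U \<in> \<T>" for U
    proof -
      obtain V where "V \<in> \<S>" "U = f ` V"
        using U img by blast
      then show ?thesis by (simp add: pre)
    qed
  qed (simp add: UT)
  moreover have "continuous_map (topology_generated_by \<T>) (topology_generated_by \<S>) ?g"
  proof (rule continuous_map_generated)
    show "?g ` \<Union>\<T> \<subseteq> \<Union>\<S>"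
      unfolding UT using gf by (simp add: image_subset_iff del: Union_iff)
    show "?g -` V \<inter> \<Union>\<T> \<in> \<T>" if "V \<in> \<S>" for V
      unfolding gpre[OF that] using that img by blast
  qed
  ultimately have "homeomorphic_maps (topology_generated_by \<S>) (topology_generated_by \<T>) f ?g"
    unfolding homeomorphic_maps_def topology_generated_by_topspace UT
    using gf by (simp del: Union_iff)
  then show ?thesis
    using homeomorphic_map_maps by blast
qed

text \<open>The Alexander subbase theorem, carried from its \<open>relative_to\<close> form over to
  \<open>topology_generated_by\<close>. The two topologies agree since each contains the subbase and
  is the coarsest one doing so.\<close>

lemma compact_space_generated:
  assumes "\<And>C. \<lbrakk>C \<subseteq> \<B>; \<Union>C = \<Union>\<B>\<rbrakk> \<Longrightarrow> \<exists>C'. finite C' \<and> C' \<subseteq> C \<and> \<Union>C' = \<Union>\<B>"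
  shows "compact_space (topology_generated_by \<B>)"
proof (rule Alexander_subbase)
  let ?X = "topology (arbitrary union_of (finite intersection_of (\<lambda>x. x \<in> \<B>) relative_to \<Union>\<B>))"
  have "openin ?X W" if "openin (topology_generated_by \<B>) W" for W
    using that
  proof (rule openin_generated_minimal)
    fix U assume U: "U \<in> \<B>"
    then have "(finite intersection_of (\<lambda>x. x \<in> \<B>) relative_to \<Union>\<B>) U"
      by (metis Inf_lower Sup_upper finite_intersection_of_inc inf.absorb_iff2 relative_to_def)
    then show "openin ?X U"
      unfolding topology_inverse'[OF istopology_subbase] by (rule arbitrary_union_of_inc)
  qed
  moreover have "openin (topology_generated_by \<B>) W" if "openin ?X W" for W
    by (rule minimal_topology_subbase[OF _ _ that])
      (auto intro: topology_generated_by_Basis)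
  ultimately show "?X = topology_generated_by \<B>"
    unfolding topology_eq by blast
qed (use assms in simp)


section \<open>Prime filters\<close>

lemma lattice_filter_up: "lattice_filter F \<Longrightarrow> a \<in> F \<Longrightarrow> a \<le> b \<Longrightarrow> b \<in> F"
  unfolding lattice_filter_def by blast

lemma lattice_filter_inf: "lattice_filter F \<Longrightarrow> a \<in> F \<Longrightarrow> b \<in> F \<Longrightarrow> inf a b \<in> F"
  unfolding lattice_filter_def by blast

lemma lattice_filter_inf_iff: "lattice_filter F \<Longrightarrow> inf a b \<in> F \<longleftrightarrow> a \<in> F \<and> b \<in> F"
  by (meson inf_le1 inf_le2 lattice_filter_inf lattice_filter_up)

lemma lattice_filter_top: "lattice_filter F \<Longrightarrow> top \<in> F"
  unfolding lattice_filter_def by (meson ex_in_conv top_greatest)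

lemma prime_filter_lattice_filter: "prime_filter x \<Longrightarrow> lattice_filter x"
  unfolding prime_filter_def by blast

lemma prime_filter_sup_iff: "prime_filter x \<Longrightarrow> sup a b \<in> x \<longleftrightarrow> a \<in> x \<or> b \<in> x"
  unfolding prime_filter_def by (meson lattice_filter_up sup_ge1 sup_ge2)

lemma prime_filter_bot: "prime_filter x \<Longrightarrow> bot \<notin> x"
  unfolding prime_filter_def using lattice_filter_up[of x bot] bot_least by blast

lemmas prime_filter_simps =
  lattice_filter_inf_iff[OF prime_filter_lattice_filter] prime_filter_sup_iff
  lattice_filter_top[OF prime_filter_lattice_filter] prime_filter_bot

text \<open>The empty family is included: its intersection \<open>UNIV\<close> is the improper
  filter, which will correspond to the empty closed set.\<close>

lemma lattice_filter_Inter: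
  assumes "\<And>F. F \<in> \<F> \<Longrightarrow> lattice_filter F"
  shows "lattice_filter (\<Inter>\<F>)"
proof -
  have "top \<in> \<Inter>\<F>"
    using assms lattice_filter_top by blast
  then show ?thesis
    using assms unfolding lattice_filter_def by blast
qed

text \<open>This is the filter generated by \<open>M\<close> and \<open>a\<close>, the enlargement
  to be played against a maximal \<open>M\<close>.\<close>

lemma lattice_filter_adjoin:
  assumes "lattice_filter M"
  shows "lattice_filter {c. \<exists>m\<in>M. inf m a \<le> c}" (is "lattice_filter ?G")
  unfolding lattice_filter_def
proof (intro conjI allI impI)
  show "?G \<noteq> {}" using lattice_filter_top[OF assms] by blast
  show "c \<in> ?G" if "b \<in> ?G" "b \<le> c" for b c
    using that order_trans by blast
  fix b c assume "b \<in> ?G" "c \<in> ?G"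
  then obtain m n where mn: "m \<in> M" "n \<in> M" "inf m a \<le> b" "inf n a \<le> c"
    by blast
  have "inf (inf m n) a \<le> inf b c"
    using mn(3,4) by (meson inf_mono inf_le1 inf_le2 le_inf_iff order_refl order_trans)
  then show "inf b c \<in> ?G"
    using lattice_filter_inf[OF assms mn(1,2)] by blast
qed

definition lattice_ideal :: "'a::bounded_lattice set \<Rightarrow> bool" where
  "lattice_ideal I \<longleftrightarrow> bot \<in> I \<and> (\<forall>a b. b \<in> I \<longrightarrow> a \<le> b \<longrightarrow> a \<in> I) \<and>
     (\<forall>a b. a \<in> I \<longrightarrow> b \<in> I \<longrightarrow> sup a b \<in> I)"

text \<open>Stone's argument: Zorn's lemma yields a filter maximal among those that contain
  \<open>F\<close> and miss \<open>I\<close>, and distributivity makes it prime.\<close>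

theorem prime_filter_theorem:
  fixes F I :: "'a::{distrib_lattice,bounded_lattice} set"
  assumes F: "lattice_filter F" and I: "lattice_ideal I" and FI: "F \<inter> I = {}"
  obtains x where "prime_filter x" "F \<subseteq> x" "x \<inter> I = {}"
proof -
  define \<A> where "\<A> = {G. lattice_filter G \<and> F \<subseteq> G \<and> G \<inter> I = {}}"
  have "\<exists>M\<in>\<A>. \<forall>G\<in>\<A>. M \<subseteq> G \<longrightarrow> G = M"
  proof (rule subset_Zorn_nonempty)
    show "\<A> \<noteq> {}" using F FI unfolding \<A>_def by blast
    fix \<C> assume ne: "\<C> \<noteq> {}" and ch: "subset.chain \<A> \<C>"
    have filt: "lattice_filter G" "F \<subseteq> G" "G \<inter> I = {}" if "G \<in> \<C>" for G
      using ch that unfolding subset.chain_def \<A>_def by blast+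
    have "lattice_filter (\<Union>\<C>)"
      unfolding lattice_filter_def
    proof (intro conjI allI impI)
      obtain G where "G \<in> \<C>" using ne by blast
      then show "\<Union>\<C> \<noteq> {}" using filt(1) lattice_filter_top by blast
      show "b \<in> \<Union>\<C>" if "a \<in> \<Union>\<C>" "a \<le> b" for a b
        using that filt(1) lattice_filter_up by blast
      fix a b assume "a \<in> \<Union>\<C>" "b \<in> \<Union>\<C>"
      then obtain G H where GH: "G \<in> \<C>" "a \<in> G" "H \<in> \<C>" "b \<in> H" by blast
      then have "G \<subseteq> H \<or> H \<subseteq> G"
        using ch unfolding subset.chain_def by blast
      then show "inf a b \<in> \<Union>\<C>"
        using GH filt(1) lattice_filter_inf by blast
    qed
    then show "\<Union>\<C> \<in> \<A>"
      unfolding \<A>_def using ne filt(2,3) by blast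
  qed
  then obtain M where "M \<in> \<A>" and max: "\<And>G. G \<in> \<A> \<Longrightarrow> M \<subseteq> G \<Longrightarrow> G = M"
    by blast
  then have M: "lattice_filter M" "F \<subseteq> M" "M \<inter> I = {}"
    unfolding \<A>_def by blast+
  \<comment> \<open>By maximality, adjoining \<open>a\<close> must produce a filter that meets
    \<open>I\<close>. Since \<open>I\<close> is a downset, it then contains one of the generating
    meets \<open>inf m a\<close>.\<close>
  have meets: "\<exists>m\<in>M. inf m a \<in> I" if a: "a \<notin> M" for a
  proof (rule ccontr)
    assume contra: "\<not> ?thesis"
    let ?G = "{c. \<exists>m\<in>M. inf m a \<le> c}"
    have MG: "M \<subseteq> ?G" using inf_le1 by blast
    have "?G \<inter> I = {}"
      using contra I unfolding lattice_ideal_def by blast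
    then have "?G \<in> \<A>"
      using lattice_filter_adjoin[OF M(1)] MG M(2) unfolding \<A>_def by blast
    then have "?G = M" using max MG by blast
    moreover have "a \<in> ?G"
      using lattice_filter_top[OF M(1)] inf_le2 by blast
    ultimately show False using a by blast
  qed
  have "a \<in> M \<or> b \<in> M" if ab: "sup a b \<in> M" for a b
  proof (rule ccontr)
    assume "\<not> (a \<in> M \<or> b \<in> M)"
    then obtain m n where mn: "m \<in> M" "n \<in> M" "inf m a \<in> I" "inf n b \<in> I"
      using meets by blast
    let ?p = "inf m n"
    \<comment> \<open>Distributivity enters here: cut down by \<open>?p\<close>, the join
      \<open>sup a b\<close> falls below a join of two elements of \<open>I\<close>, which puts an
      element of \<open>M\<close> into \<open>I\<close>.\<close>
    have "inf ?p (sup a b) \<le> sup (inf m a) (inf n b)"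
      unfolding inf_sup_distrib1 by (intro sup_mono inf_mono) simp_all
    moreover have "sup (inf m a) (inf n b) \<in> I"
      using mn I unfolding lattice_ideal_def by blast
    ultimately have "inf ?p (sup a b) \<in> I"
      using I unfolding lattice_ideal_def by blast
    moreover have "inf ?p (sup a b) \<in> M"
      using mn ab M(1) by (simp add: lattice_filter_inf)
    ultimately show False using M(3) by blast
  qed
  moreover have "M \<noteq> UNIV"
    using M(3) I unfolding lattice_ideal_def by blast
  ultimately have "prime_filter M"
    using M(1) unfolding prime_filter_def by blast
  then show thesis using that M by blast
qed

text \<open>The case of the principal ideal of \<open>a\<close>. A filter is thus the intersection
  of the prime filters above it, which is why \<open>upper_hull\<close> will lose no
  information.\<close>

corollary prime_filter_separation:
  fixes F :: "'a::{distrib_lattice,bounded_lattice} set"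
  assumes "lattice_filter F" "a \<notin> F"
  obtains x where "prime_filter x" "F \<subseteq> x" "a \<notin> x"
proof (rule prime_filter_theorem[of F "{..a}"])
  show "lattice_ideal {..a}"
    unfolding lattice_ideal_def by auto
  show "F \<inter> {..a} = {}"
    using assms lattice_filter_up by blast
qed (use assms that in auto)


section \<open>Priestley spaces\<close>

definition plus_set :: "'a::{distrib_lattice,bounded_lattice} \<Rightarrow> 'a set set" where
  "plus_set a = {x. prime_filter x \<and> a \<in> x}"

definition minus_set :: "'a::{distrib_lattice,bounded_lattice} \<Rightarrow> 'a set set" where
  "minus_set a = {x. prime_filter x \<and> a \<notin> x}"

lemma priestley_space_eq:
  "priestley_space = topology_generated_by (range plus_set \<union> range minus_set)"
  unfolding priestley_space_def plus_set_def minus_set_def ..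

lemma plus_set_simps:
  "plus_set bot = {}" "plus_set top = {x. prime_filter x}"
  "plus_set (inf a b) = plus_set a \<inter> plus_set b" "plus_set (sup a b) = plus_set a \<union> plus_set b"
  unfolding plus_set_def by (auto simp: prime_filter_simps)

lemma minus_set_simps:
  "minus_set bot = {x. prime_filter x}" "minus_set top = {}"
  "minus_set (inf a b) = minus_set a \<union> minus_set b"
  "minus_set (sup a b) = minus_set a \<inter> minus_set b"
  unfolding minus_set_def by (auto simp: prime_filter_simps)

lemma compl_minus_set: "{x. prime_filter x} - minus_set a = plus_set a"
  unfolding plus_set_def minus_set_def by blast

lemma openin_plus_set: "openin priestley_space (plus_set a)"
  unfolding priestley_space_eq by (rule topology_generated_by_Basis) blast

lemma openin_minus_set: "openin priestley_space (minus_set a)"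
  unfolding priestley_space_eq by (rule topology_generated_by_Basis) blast

lemma closedin_minus_set: "closedin priestley_space (minus_set a)"
  unfolding closedin_def topspace_priestley_space compl_minus_set
  using openin_plus_set by (auto simp: minus_set_def)

lemma Union_plus_minus: "\<Union>(range plus_set \<union> range minus_set) = {x. prime_filter x}"
  unfolding plus_set_def minus_set_def by blast

text \<open>The Alexander subbase theorem leaves only covers by sets \<open>plus_set a\<close> and
  \<open>minus_set b\<close>. A point missed by such a cover is a prime filter containing every such
  \<open>b\<close> and no such \<open>a\<close>, which is what \<open>prime_filter_theorem\<close>
  can supply.\<close>

lemma compact_priestley_space: "compact_space priestley_space"
  unfolding priestley_space_eq
proof (rule compact_space_generated, unfold Union_plus_minus)
  fix C :: "'a set set set"
  assume C: "C \<subseteq> range plus_set \<union> range minus_set" and cov: "\<Union>C = {x. prime_filter x}"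
  \<comment> \<open>Without a finite subcover, the ideal \<open>I\<close> and the filter \<open>F\<close> below are disjoint, and a prime
    filter separating them is a point that \<open>C\<close> leaves uncovered.\<close>
  define A where "A = {a. plus_set a \<in> C}"
  define B where "B = {b. minus_set b \<in> C}"
  define I where "I = {c. \<exists>A0. finite A0 \<and> A0 \<subseteq> A \<and> plus_set c \<subseteq> \<Union>(plus_set ` A0)}"
  define F where "F = {c. \<exists>B0. finite B0 \<and> B0 \<subseteq> B \<and> minus_set c \<subseteq> \<Union>(minus_set ` B0)}"
  have AI: "A \<subseteq> I"
  proof
    fix a assume "a \<in> A"
    then show "a \<in> I" unfolding I_def by (intro CollectI exI[of _ "{a}"]) auto
  qed
  have BF: "B \<subseteq> F"
  proof
    fix b assume "b \<in> B"
    then show "b \<in> F" unfolding F_def by (intro CollectI exI[of _ "{b}"]) auto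
  qed
  have I: "lattice_ideal I"
    unfolding lattice_ideal_def
  proof (intro conjI allI impI)
    show "bot \<in> I" unfolding I_def by (intro CollectI exI[of _ "{}"]) (simp add: plus_set_simps)
    fix a b
    show "a \<in> I" if "b \<in> I" "a \<le> b"
    proof -
      have "plus_set a \<subseteq> plus_set b"
        using that(2) plus_set_simps(3)[of a b] by (simp add: inf_absorb1 le_iff_inf)
      then show ?thesis using that(1) unfolding I_def by blast
    qed
    assume "a \<in> I" "b \<in> I"
    then obtain A1 A2 where "finite A1" "A1 \<subseteq> A" "plus_set a \<subseteq> \<Union>(plus_set ` A1)"
      "finite A2" "A2 \<subseteq> A" "plus_set b \<subseteq> \<Union>(plus_set ` A2)"
      unfolding I_def by blast
    then show "sup a b \<in> I"
      unfolding I_def by (intro CollectI exI[of _ "A1 \<union> A2"]) (auto simp: plus_set_simps)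
  qed
  have F: "lattice_filter F"
    unfolding lattice_filter_def
  proof (intro conjI allI impI)
    have "top \<in> F" unfolding F_def by (intro CollectI exI[of _ "{}"]) (simp add: minus_set_simps)
    then show "F \<noteq> {}" by blast
    fix a b
    show "b \<in> F" if "a \<in> F" "a \<le> b"
    proof -
      have "minus_set b \<subseteq> minus_set a"
        using that(2) minus_set_simps(3)[of a b] by (simp add: inf_absorb1 subset_Un_eq Un_commute)
      then show ?thesis using that(1) unfolding F_def by blast
    qed
    assume "a \<in> F" "b \<in> F"
    then obtain B1 B2 where "finite B1" "B1 \<subseteq> B" "minus_set a \<subseteq> \<Union>(minus_set ` B1)"
      "finite B2" "B2 \<subseteq> B" "minus_set b \<subseteq> \<Union>(minus_set ` B2)"
      unfolding F_def by blast
    then show "inf a b \<in> F"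
      unfolding F_def by (intro CollectI exI[of _ "B1 \<union> B2"]) (auto simp: minus_set_simps)
  qed
  have "F \<inter> I \<noteq> {}"
  proof
    assume "F \<inter> I = {}"
    then obtain x where x: "prime_filter x" "F \<subseteq> x" "x \<inter> I = {}"
      using prime_filter_theorem[OF F I] by blast
    then obtain U where U: "U \<in> C" "x \<in> U" using cov by blast
    then consider a where "U = plus_set a" | b where "U = minus_set b" using C by blast
    then show False
    proof cases
      case 1
      then have "a \<in> I" "a \<in> x" using U AI unfolding A_def plus_set_def by auto
      then show False using x by blast
    next
      case 2
      then have "b \<in> F" "b \<notin> x" using U BF unfolding B_def minus_set_def by auto
      then show False using x by blast
    qed
  qed
  \<comment> \<open>The common element \<open>c\<close> cuts the space into
    \<open>plus_set c\<close> and \<open>minus_set c\<close>. Membership in \<open>I\<close> covers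
    the first piece by finitely many members of \<open>C\<close>, membership in \<open>F\<close> the
    second.\<close>
  then obtain c where c: "c \<in> F" "c \<in> I" by blast
  obtain A0 where A0: "finite A0" "A0 \<subseteq> A" "plus_set c \<subseteq> \<Union>(plus_set ` A0)"
    using c(2) unfolding I_def by blast
  obtain B0 where B0: "finite B0" "B0 \<subseteq> B" "minus_set c \<subseteq> \<Union>(minus_set ` B0)"
    using c(1) unfolding F_def by blast
  let ?C = "plus_set ` A0 \<union> minus_set ` B0"
  have sub: "?C \<subseteq> C" using A0(2) B0(2) unfolding A_def B_def by blast
  have "{x. prime_filter x} = plus_set c \<union> minus_set c"
    unfolding plus_set_def minus_set_def by blast
  then have "{x. prime_filter x} \<subseteq> \<Union>?C"
    using A0(3) B0(3) by auto
  then have "\<Union>?C = {x. prime_filter x}"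
    using Union_mono[OF sub] cov by (simp add: subset_antisym)
  then show "\<exists>C'. finite C' \<and> C' \<subseteq> C \<and> \<Union>C' = {x. prime_filter x}"
    using sub A0(1) B0(1) by (intro exI[of _ ?C]) simp
qed

text \<open>The union belongs to the meet of \<open>A\<close>, which stays in the filter; the empty
  union belongs to \<open>top\<close>. A finite subcover indexed by a filter thus shrinks to a
  single element of that filter.\<close>

lemma Union_minus_set_finite:
  assumes "finite A" "lattice_filter F" "A \<subseteq> F"
  shows "\<exists>c\<in>F. \<Union>(minus_set ` A) = minus_set c"
  using assms
proof (induction A)
  case empty
  then show ?case using lattice_filter_top minus_set_simps(2) by blast
next
  case (insert a A)
  then obtain c where "c \<in> F" "\<Union>(minus_set ` A) = minus_set c" by blast
  then show ?case
    using insert.prems by (intro bexI[of _ "inf a c"]) (simp_all add: minus_set_simps lattice_filter_inf)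
qed

text \<open>The dual with joins, where primality keeps the join outside \<open>x\<close> and
  properness handles the empty union.\<close>

lemma Union_plus_set_finite:
  assumes "finite A" "prime_filter x" "A \<inter> x = {}"
  shows "\<exists>c. c \<notin> x \<and> \<Union>(plus_set ` A) = plus_set c"
  using assms
proof (induction A)
  case empty
  then show ?case using prime_filter_bot plus_set_simps(1) by blast
next
  case (insert a A)
  then obtain c where "c \<notin> x" "\<Union>(plus_set ` A) = plus_set c" by blast
  then show ?case
    using insert.prems by (intro exI[of _ "sup a c"]) (simp add: plus_set_simps prime_filter_sup_iff)
qed

text \<open>A point outside the upset \<open>U\<close> does not contain \<open>x\<close>, so it
  omits some element of \<open>x\<close>. Hence the compact complement of \<open>U\<close> is
  covered by the sets \<open>minus_set a\<close> with \<open>a\<close> in \<open>x\<close>, and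
  finitely many of these merge into one.\<close>

lemma openin_priestley_plus_basic:
  assumes U: "openin priestley_plus U" and x: "x \<in> U"
  obtains a where "x \<in> plus_set a" "plus_set a \<subseteq> U"
proof -
  have U': "openin priestley_space U" "upset_in {x. prime_filter x} U"
    using U unfolding priestley_plus_def openin_upset_topology topspace_priestley_space by blast+
  then have px: "prime_filter x" using x unfolding upset_in_def by blast
  let ?K = "{x. prime_filter x} - U"
  have "compactin priestley_space ?K"
    by (rule closedin_compact_space[OF compact_priestley_space])
      (metis U'(1) closedin_diff closedin_topspace openin_closedin_eq topspace_priestley_space)
  moreover have "?K \<subseteq> \<Union>(minus_set ` x)"
    using U'(2) x unfolding upset_in_def minus_set_def by blast
  moreover have "\<forall>V\<in>minus_set ` x. openin priestley_space V"
    using openin_minus_set by blast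
  ultimately obtain \<F> where "finite \<F>" "\<F> \<subseteq> minus_set ` x" "?K \<subseteq> \<Union>\<F>"
    unfolding compactin_def by meson
  then obtain A where A: "finite A" "A \<subseteq> x" "?K \<subseteq> \<Union>(minus_set ` A)"
    by (metis finite_subset_image)
  then obtain c where "c \<in> x" "\<Union>(minus_set ` A) = minus_set c"
    using Union_minus_set_finite prime_filter_lattice_filter[OF px] by metis
  then have "x \<in> plus_set c" "plus_set c \<subseteq> U"
    using A(3) px unfolding plus_set_def minus_set_def by auto
  then show thesis by (rule that)
qed

text \<open>The same compactness argument with inclusion reversed: a point outside the downset
  \<open>U\<close> is not contained in \<open>x\<close>, so it has an element outside
  \<open>x\<close>.\<close>

lemma openin_priestley_minus_basic:
  assumes U: "openin priestley_minus U" and x: "x \<in> U"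
  obtains a where "x \<in> minus_set a" "minus_set a \<subseteq> U"
proof -
  have U': "openin priestley_space U" "downset_in {x. prime_filter x} U"
    using U unfolding priestley_minus_def openin_downset_topology topspace_priestley_space by blast+
  then have px: "prime_filter x" using x unfolding downset_in_def by blast
  let ?K = "{x. prime_filter x} - U"
  have "compactin priestley_space ?K"
    by (rule closedin_compact_space[OF compact_priestley_space])
      (metis U'(1) closedin_diff closedin_topspace openin_closedin_eq topspace_priestley_space)
  moreover have "?K \<subseteq> \<Union>(plus_set ` (- x))"
    using U'(2) x unfolding downset_in_def plus_set_def by blast
  moreover have "\<forall>V\<in>plus_set ` (- x). openin priestley_space V"
    using openin_plus_set by blast
  ultimately obtain \<F> where "finite \<F>" "\<F> \<subseteq> plus_set ` (- x)" "?K \<subseteq> \<Union>\<F>"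
    unfolding compactin_def by meson
  then obtain A where A: "finite A" "A \<subseteq> - x" "?K \<subseteq> \<Union>(plus_set ` A)"
    by (metis finite_subset_image)
  then obtain c where "c \<notin> x" "\<Union>(plus_set ` A) = plus_set c"
    using Union_plus_set_finite[OF A(1) px] by blast
  then have "x \<in> minus_set c" "minus_set c \<subseteq> U"
    using A(3) px unfolding plus_set_def minus_set_def by auto
  then show thesis by (rule that)
qed

lemma openin_priestley_plus: "openin priestley_plus (plus_set a)"
  unfolding priestley_plus_def openin_upset_topology topspace_priestley_space upset_in_def
  using openin_plus_set by (auto simp: plus_set_def)

lemma openin_priestley_minus: "openin priestley_minus (minus_set a)"
  unfolding priestley_minus_def openin_downset_topology topspace_priestley_space downset_in_def
  using openin_minus_set by (auto simp: minus_set_def)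

lemma priestley_plus_eq: "priestley_plus = topology_generated_by (range plus_set)"
  unfolding topology_eq
proof (intro allI iffI)
  show "openin (topology_generated_by (range plus_set)) U" if "openin priestley_plus U" for U :: "'a set set"
    by (subst openin_subopen)
      (metis that openin_priestley_plus_basic rangeI topology_generated_by_Basis)
  show "openin priestley_plus U" if "openin (topology_generated_by (range plus_set)) U" for U :: "'a set set"
    using that by (rule openin_generated_minimal) (use openin_priestley_plus in blast)
qed

lemma priestley_minus_eq: "priestley_minus = topology_generated_by (range minus_set)"
  unfolding topology_eq
proof (intro allI iffI)
  show "openin (topology_generated_by (range minus_set)) U" if "openin priestley_minus U" for U :: "'a set set"
    by (subst openin_subopen)
      (metis that openin_priestley_minus_basic rangeI topology_generated_by_Basis)
  show "openin priestley_minus U" if "openin (topology_generated_by (range minus_set)) U" for U :: "'a set set"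
    using that by (rule openin_generated_minimal) (use openin_priestley_minus in blast)
qed

text \<open>Being closed in a compact space, the set is compact there, and compactness survives in
  the coarser downset topology. This makes \<open>box_set (minus_set a)\<close> a generator of
  \<open>hyper_box\<close>.\<close>

lemma compactin_minus_set: "compactin priestley_minus (minus_set a)"
proof (rule compactin_contractive)
  show "compactin priestley_space (minus_set a)"
    by (rule closedin_compact_space[OF compact_priestley_space closedin_minus_set])
qed (simp_all add: priestley_minus_def topspace_downset_topology openin_downset_topology)


section \<open>Closed upsets and filters\<close>

text \<open>The closed upset that Priestley duality assigns to a filter.\<close>

definition upper_hull :: "'a::{distrib_lattice,bounded_lattice} set \<Rightarrow> 'a set set" where
  "upper_hull F = {x. prime_filter x \<and> F \<subseteq> x}"

text \<open>An element of \<open>F\<close> missing from \<open>G\<close> is also missing from some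
  prime filter above \<open>G\<close>. The reversal of inclusion here is the source of the duality
  in the theorem.\<close>

lemma upper_hull_mono_iff:
  assumes "lattice_filter G"
  shows "upper_hull G \<subseteq> upper_hull F \<longleftrightarrow> F \<subseteq> G"
proof
  assume sub: "upper_hull G \<subseteq> upper_hull F"
  show "F \<subseteq> G"
  proof (rule subsetI, rule ccontr)
    fix a assume a: "a \<in> F" "a \<notin> G"
    then obtain x where "prime_filter x" "G \<subseteq> x" "a \<notin> x"
      using prime_filter_separation[OF assms] by blast
    then show False using sub a unfolding upper_hull_def by blast
  qed
qed (auto simp: upper_hull_def)

text \<open>The dictionary between filters and hyperspace: membership of \<open>a\<close> becomes a
  box condition and non-membership a diamond condition, both for \<open>minus_set a\<close>.\<close>

lemma upper_hull_disjoint_iff: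
  assumes "lattice_filter F"
  shows "upper_hull F \<inter> minus_set a = {} \<longleftrightarrow> a \<in> F"
proof
  assume disj: "upper_hull F \<inter> minus_set a = {}"
  show "a \<in> F"
  proof (rule ccontr)
    assume "a \<notin> F"
    then obtain x where "prime_filter x" "F \<subseteq> x" "a \<notin> x"
      using prime_filter_separation[OF assms] by blast
    then show False using disj unfolding upper_hull_def minus_set_def by blast
  qed
qed (auto simp: upper_hull_def minus_set_def)

lemma upper_hull_hyper_minus: "upper_hull F \<in> hyper_minus"
proof -
  have "{x. prime_filter x} - upper_hull F = \<Union>(minus_set ` F)"
    unfolding upper_hull_def minus_set_def by blast
  then have "openin priestley_minus ({x. prime_filter x} - upper_hull F)"
    using openin_priestley_minus by auto
  then show ?thesis
    unfolding hyper_minus_def closedin_def topspace_priestley_minus by (auto simp: upper_hull_def)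
qed

text \<open>The filter is the intersection of \<open>C\<close>. A point above it but outside
  \<open>C\<close> would have a neighbourhood \<open>minus_set a\<close> missing \<open>C\<close>;
  then \<open>a\<close> lies in every member of \<open>C\<close>, hence in that point, a
  contradiction. For empty \<open>C\<close> the filter is improper.\<close>

lemma hyper_minus_upper_hull:
  assumes "C \<in> hyper_minus"
  obtains F where "lattice_filter F" "C = upper_hull F"
proof -
  have C: "C \<subseteq> {x. prime_filter x}" "openin priestley_minus ({x. prime_filter x} - C)"
    using assms unfolding hyper_minus_def closedin_def topspace_priestley_minus by blast+
  have "upper_hull (\<Inter>C) \<subseteq> C"
  proof (rule subsetI, rule ccontr)
    fix x assume x: "x \<in> upper_hull (\<Inter>C)" "x \<notin> C"
    then have "x \<in> {x. prime_filter x} - C" unfolding upper_hull_def by blast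
    then obtain a where a: "x \<in> minus_set a" "minus_set a \<subseteq> {x. prime_filter x} - C"
      using openin_priestley_minus_basic[OF C(2)] by blast
    then have "a \<in> \<Inter>C" using C(1) unfolding minus_set_def by blast
    then show False using x a unfolding upper_hull_def minus_set_def by blast
  qed
  then have "C = upper_hull (\<Inter>C)"
    using C(1) unfolding upper_hull_def by blast
  moreover have "lattice_filter (\<Inter>C)"
    using C(1) prime_filter_lattice_filter by (blast intro: lattice_filter_Inter)
  ultimately show thesis using that by blast
qed

text \<open>A compact \<open>K\<close> disjoint from \<open>upper_hull F\<close> is covered by the
  sets \<open>minus_set a\<close> with \<open>a\<close> in \<open>F\<close>, hence by a single
  \<open>minus_set c\<close> with \<open>c\<close> in \<open>F\<close>, which
  \<open>upper_hull F\<close> still misses.\<close>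

lemma hyper_box_eq: "hyper_box = topology_generated_by (range (\<lambda>a. box_set (minus_set a)))"
  unfolding hyper_box_def
proof (rule topology_generated_by_eqI)
  let ?T = "topology_generated_by (range (\<lambda>a. box_set (minus_set a :: 'a set set)))"
  have basic: "openin ?T (box_set (minus_set a))" for a
    by (rule topology_generated_by_Basis) blast
  fix W :: "'a set set set"
  assume "W \<in> insert hyper_minus {box_set K |K. compactin priestley_minus K}"
  then consider "W = hyper_minus" | K where "compactin priestley_minus K" "W = box_set K" by blast
  then show "openin ?T W"
  proof cases
    case 1
    \<comment> \<open>\<open>minus_set top\<close> is empty, so every closed set misses it.\<close>
    then have "W = box_set (minus_set top)"
      by (simp add: box_set_def minus_set_simps)
    then show ?thesis using basic by simp
  next
    case 2
    have "\<exists>a. C \<in> box_set (minus_set a) \<and> box_set (minus_set a) \<subseteq> W" if "C \<in> W" for C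
    proof -
      have C: "C \<in> hyper_minus" "C \<inter> K = {}" using that 2 unfolding box_set_def by blast+
      then obtain F where F: "lattice_filter F" "C = upper_hull F"
        using hyper_minus_upper_hull by blast
      have "K \<subseteq> {x. prime_filter x}"
        using compactin_subset_topspace[OF 2(1)] by (simp add: topspace_priestley_minus)
      then have "K \<subseteq> \<Union>(minus_set ` F)"
        using C(2) unfolding F(2) upper_hull_def minus_set_def by blast
      moreover have "\<forall>V\<in>minus_set ` F. openin priestley_minus V"
        using openin_priestley_minus by blast
      ultimately obtain \<F> where "finite \<F>" "\<F> \<subseteq> minus_set ` F" "K \<subseteq> \<Union>\<F>"
        using 2(1) unfolding compactin_def by meson
      then obtain A where A: "finite A" "A \<subseteq> F" "K \<subseteq> \<Union>(minus_set ` A)"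
        by (metis finite_subset_image)
      then obtain c where c: "c \<in> F" "\<Union>(minus_set ` A) = minus_set c"
        using Union_minus_set_finite F(1) by metis
      have "C \<inter> minus_set c = {}"
        using c(1) F by (simp add: upper_hull_disjoint_iff)
      then have "C \<in> box_set (minus_set c)"
        using C(1) by (simp add: box_set_def)
      moreover have "box_set (minus_set c) \<subseteq> box_set K"
        using A(3) unfolding c(2) box_set_def by blast
      ultimately show ?thesis unfolding 2(2) by blast
    qed
    then show ?thesis
      by (subst openin_subopen) (use basic in blast)
  qed
qed (use compactin_minus_set in \<open>blast intro: topology_generated_by_Basis\<close>)

text \<open>A point witnessing that \<open>C\<close> meets \<open>U\<close> has a basic
  neighbourhood \<open>minus_set a\<close> inside \<open>U\<close>, and \<open>C\<close> meets that
  too. The whole hyperspace stays in the subbase because the empty closed set lies in no diamond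
  set.\<close>

lemma hyper_diamond_eq:
  "hyper_diamond = topology_generated_by (insert hyper_minus (range (\<lambda>a. diamond_set (minus_set a))))"
  unfolding hyper_diamond_def
proof (rule topology_generated_by_eqI)
  let ?T = "topology_generated_by
    (insert hyper_minus (range (\<lambda>a. diamond_set (minus_set a :: 'a set set))))"
  have basic: "openin ?T (diamond_set (minus_set a))" for a
    by (rule topology_generated_by_Basis) blast
  fix W :: "'a set set set"
  assume "W \<in> insert hyper_minus {diamond_set U |U. openin priestley_minus U}"
  then consider "W = hyper_minus" | U where "openin priestley_minus U" "W = diamond_set U" by blast
  then show "openin ?T W"
  proof cases
    case 1
    then show ?thesis by (auto intro: topology_generated_by_Basis)
  next
    case 2
    have "\<exists>a. C \<in> diamond_set (minus_set a) \<and> diamond_set (minus_set a) \<subseteq> W" if "C \<in> W" for C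
    proof -
      obtain x where x: "C \<in> hyper_minus" "x \<in> C" "x \<in> U"
        using \<open>C \<in> W\<close> 2(2) unfolding diamond_set_def by blast
      then obtain a where "x \<in> minus_set a" "minus_set a \<subseteq> U"
        using openin_priestley_minus_basic[OF 2(1)] by blast
      then show ?thesis using x unfolding 2(2) diamond_set_def by blast
    qed
    then show ?thesis
      by (subst openin_subopen) (use basic in blast)
  qed
qed (use openin_priestley_minus in \<open>blast intro: topology_generated_by_Basis\<close>)

lemma hyper_diamond_box_eq:
  "hyper_diamond_box = topology_generated_by
    (range (\<lambda>a. box_set (minus_set a)) \<union> range (\<lambda>a. diamond_set (minus_set a)))"
  unfolding hyper_diamond_box_def
proof (rule topology_generated_by_eqI)
  let ?S = "range (\<lambda>a. box_set (minus_set a :: 'a set set)) \<union> range (\<lambda>a. diamond_set (minus_set a))"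
  fix W :: "'a set set set"
  assume "W \<in> {W. openin hyper_diamond W} \<union> {W. openin hyper_box W}"
  then consider "openin hyper_diamond W" | "openin hyper_box W" by blast
  then show "openin (topology_generated_by ?S) W"
  proof cases
    case 1
    then show ?thesis unfolding hyper_diamond_eq
    proof (rule openin_generated_minimal)
      \<comment> \<open>The box generators already supply the whole hyperspace that the diamond
        subbase lists separately.\<close>
      have "hyper_minus = box_set (minus_set (top :: 'a))"
        by (simp add: box_set_def minus_set_simps)
      then show "openin (topology_generated_by ?S) U"
        if "U \<in> insert hyper_minus (range (\<lambda>a. diamond_set (minus_set a)))" for U
        using that by (intro topology_generated_by_Basis) blast
    qed
  next
    case 2
    then show ?thesis unfolding hyper_box_eq
      by (rule openin_generated_minimal) (intro topology_generated_by_Basis, blast)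
  qed
next
  fix W :: "'a set set set"
  assume "W \<in> range (\<lambda>a. box_set (minus_set a)) \<union> range (\<lambda>a. diamond_set (minus_set a))"
  then have "openin hyper_box W \<or> openin hyper_diamond W"
    unfolding hyper_box_eq hyper_diamond_eq by (blast intro: topology_generated_by_Basis)
  then show "openin (topology_generated_by ({W. openin hyper_diamond W} \<union> {W. openin hyper_box W})) W"
    by (intro topology_generated_by_Basis) blast
qed


section \<open>Prime filters of the free lattice\<close>

text \<open>Term induction carried through the quotient: every element is the class of a
  term.\<close>

lemma free_box_induct [case_names gen bot top inf sup]:
  fixes d :: "'a::{distrib_lattice,bounded_lattice} free_box"
  assumes "\<And>a. P (box_gen a)" "P bot" "P top"
    "\<And>d e. P d \<Longrightarrow> P e \<Longrightarrow> P (inf d e)" "\<And>d e. P d \<Longrightarrow> P e \<Longrightarrow> P (sup d e)"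
  shows "P d"
proof -
  have "P (abs_free_box t)" for t
  proof (induction t)
    case (Gen a)
    then show ?case using assms(1)[of a] by (simp add: box_gen.abs_eq)
  next
    case (Meet s t)
    then show ?case using assms(4) by (simp flip: inf_free_box.abs_eq)
  next
    case (Join s t)
    then show ?case using assms(5) by (simp flip: sup_free_box.abs_eq)
  qed (use assms(2,3) in \<open>simp_all add: bot_free_box_def top_free_box_def\<close>)
  then show ?thesis by (metis Quotient_free_box Quotient_abs_rep)
qed

lemma box_gen_mono: "a \<le> b \<Longrightarrow> box_gen a \<le> box_gen b"
  by (metis box_gen_inf inf.absorb_iff1)

definition box_trace :: "'a::{distrib_lattice,bounded_lattice} free_box set \<Rightarrow> 'a set" where
  "box_trace x = {a. box_gen a \<in> x}"

lemma lattice_filter_box_trace: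
  assumes "prime_filter x"
  shows "lattice_filter (box_trace x)"
proof -
  have x: "lattice_filter x" using assms by (rule prime_filter_lattice_filter)
  have "top \<in> box_trace x"
    unfolding box_trace_def using lattice_filter_top[OF x] by (simp add: box_gen_top)
  moreover have "b \<in> box_trace x" if "a \<in> box_trace x" "a \<le> b" for a b
    using that lattice_filter_up[OF x] box_gen_mono unfolding box_trace_def by blast
  moreover have "inf a b \<in> box_trace x" if "a \<in> box_trace x" "b \<in> box_trace x" for a b
    using that lattice_filter_inf[OF x] unfolding box_trace_def by (simp add: box_gen_inf)
  ultimately show ?thesis
    unfolding lattice_filter_def by blast
qed

text \<open>Membership in a prime filter turns meets into conjunctions and joins into disjunctions,
  both monotone, so an inclusion that holds on the generators spreads to all elements.\<close>

lemma box_trace_mono_iff: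
  assumes x: "prime_filter x" and y: "prime_filter y"
  shows "box_trace x \<subseteq> box_trace y \<longleftrightarrow> x \<subseteq> y"
proof
  assume sub: "box_trace x \<subseteq> box_trace y"
  have "d \<in> x \<longrightarrow> d \<in> y" for d
  proof (induction d rule: free_box_induct)
    case (gen a)
    then show ?case using sub unfolding box_trace_def by blast
  qed (simp_all add: prime_filter_simps[OF x] prime_filter_simps[OF y])
  then show "x \<subseteq> y" by blast
qed (auto simp: box_trace_def)

lemma box_trace_surj:
  fixes F :: "'a::{distrib_lattice,bounded_lattice} set"
  assumes "lattice_filter F"
  obtains x where "prime_filter x" "box_trace x = F"
proof -
  \<comment> \<open>The two-element lattice is \<open>bool\<close>, with \<open>inf\<close> as
    conjunction and \<open>top\<close> as truth.\<close>
  let ?h = "\<lambda>a. a \<in> F"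
  have "?h top = top" "?h (inf a b) = inf (?h a) (?h b)" for a b
    using assms by (simp_all add: lattice_filter_top lattice_filter_inf_iff)
  then obtain f :: "'a free_box \<Rightarrow> bool" where f: "bounded_lattice_hom f" "\<And>a. f (box_gen a) = ?h a"
    using free_box_universal[of ?h] by blast
  have hom: "f bot = False" "f top = True" "f (inf d e) = (f d \<and> f e)" "f (sup d e) = (f d \<or> f e)" for d e
    using f(1) unfolding bounded_lattice_hom_def by simp_all
  have "prime_filter {d. f d}"
    unfolding prime_filter_def lattice_filter_def
  proof (intro conjI allI impI)
    show "{d. f d} \<noteq> {}" "{d. f d} \<noteq> UNIV" using hom(1,2) by blast+
    show "e \<in> {d. f d}" if "d \<in> {d. f d}" "d \<le> e" for d e
      using that hom(3)[of d e] by (simp add: inf_absorb1)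
  qed (simp_all add: hom)
  moreover have "box_trace {d. f d} = F"
    unfolding box_trace_def by (simp add: f(2))
  ultimately show thesis by (rule that)
qed

text \<open>Lattice operations become finite unions and intersections, so openness need only be
  known on generators; the whole space accounts for \<open>top\<close>.\<close>

lemma openin_plus_set_free_box:
  assumes "openin T {x. prime_filter x}" "\<And>a. openin T (plus_set (box_gen a))"
  shows "openin T (plus_set d)"
  by (induction d rule: free_box_induct) (use assms in \<open>auto simp: plus_set_simps\<close>)

lemma openin_minus_set_free_box:
  assumes "openin T {x. prime_filter x}" "\<And>a. openin T (minus_set (box_gen a))"
  shows "openin T (minus_set d)"
  by (induction d rule: free_box_induct) (use assms in \<open>auto simp: minus_set_simps\<close>)

lemma priestley_plus_free_box:
  "priestley_plus = topology_generated_by (range (\<lambda>a. plus_set (box_gen a)))"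
  unfolding priestley_plus_eq
proof (rule topology_generated_by_eqI)
  let ?T = "topology_generated_by (range (\<lambda>a. plus_set (box_gen a :: 'a free_box)))"
  have gen: "openin ?T (plus_set (box_gen a))" for a
    by (intro topology_generated_by_Basis) blast
  have "openin ?T {x. prime_filter x}"
    using gen[of top] by (simp add: box_gen_top plus_set_simps)
  then show "openin ?T U" if "U \<in> range plus_set" for U
    using that openin_plus_set_free_box gen by blast
qed (intro topology_generated_by_Basis, blast)

text \<open>The whole space is listed because the prime filter containing every
  \<open>box_gen a\<close> lies in no \<open>minus_set (box_gen a)\<close>. Under
  \<open>trace_hull\<close> it becomes the empty closed set, so this subbase matches that of
  \<open>hyper_diamond\<close>.\<close>

lemma priestley_minus_free_box:
  "priestley_minus = topology_generated_by
    (insert {x. prime_filter x} (range (\<lambda>a. minus_set (box_gen a))))"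
  unfolding priestley_minus_eq
proof (rule topology_generated_by_eqI)
  let ?T = "topology_generated_by
    (insert {x. prime_filter x} (range (\<lambda>a. minus_set (box_gen a :: 'a free_box))))"
  have "openin ?T (minus_set (box_gen a))" "openin ?T {x. prime_filter x}" for a
    by (intro topology_generated_by_Basis, blast)+
  then show "openin ?T U" if "U \<in> range minus_set" for U
    using that openin_minus_set_free_box by blast
next
  show "openin (topology_generated_by (range minus_set)) U"
    if "U \<in> insert {x. prime_filter x} (range (\<lambda>a. minus_set (box_gen a :: 'a free_box)))" for U
    using that minus_set_simps(1)[where 'a = "'a free_box"]
    by (intro topology_generated_by_Basis) blast
qed

lemma priestley_space_free_box:
  "priestley_space = topology_generated_by
    (range (\<lambda>a. plus_set (box_gen a)) \<union> range (\<lambda>a. minus_set (box_gen a)))"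
  unfolding priestley_space_eq
proof (rule topology_generated_by_eqI)
  let ?T = "topology_generated_by
    (range (\<lambda>a. plus_set (box_gen a :: 'a free_box)) \<union> range (\<lambda>a. minus_set (box_gen a)))"
  have gen: "openin ?T (plus_set (box_gen a))" "openin ?T (minus_set (box_gen a))" for a
    by (intro topology_generated_by_Basis, blast)+
  moreover have "openin ?T {x. prime_filter x}"
    using gen(1)[of top] by (simp add: box_gen_top plus_set_simps)
  ultimately show "openin ?T U" if "U \<in> range plus_set \<union> range minus_set" for U
    using that openin_plus_set_free_box openin_minus_set_free_box by blast
qed (intro topology_generated_by_Basis, blast)

section \<open>Images of subbasic sets under the two bijections\<close>

lemma box_trace_image:
  "box_trace ` {x. prime_filter x} = {F. lattice_filter F}"
  using lattice_filter_box_trace box_trace_surj by fastforce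

lemma box_trace_plus_set:
  "box_trace ` plus_set (box_gen a) = {F. lattice_filter F \<and> a \<in> F}"
proof -
  have "box_trace ` plus_set (box_gen a) = {F \<in> box_trace ` {x. prime_filter x}. a \<in> F}"
    unfolding plus_set_def by (auto simp: box_trace_def)
  then show ?thesis unfolding box_trace_image by simp
qed

lemma box_trace_minus_set:
  "box_trace ` minus_set (box_gen a) = {F. lattice_filter F \<and> a \<notin> F}"
proof -
  have "box_trace ` minus_set (box_gen a) = {F \<in> box_trace ` {x. prime_filter x}. a \<notin> F}"
    unfolding minus_set_def by (auto simp: box_trace_def)
  then show ?thesis unfolding box_trace_image by simp
qed

lemma upper_hull_image: "upper_hull ` {F. lattice_filter F} = hyper_minus"
  using upper_hull_hyper_minus hyper_minus_upper_hull by blast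

lemma upper_hull_filters_containing:
  "upper_hull ` {F. lattice_filter F \<and> a \<in> F} = box_set (minus_set a)"
proof -
  have "upper_hull ` {F. lattice_filter F \<and> a \<in> F}
      = {C \<in> upper_hull ` {F. lattice_filter F}. C \<inter> minus_set a = {}}"
    using upper_hull_disjoint_iff by blast
  then show ?thesis unfolding upper_hull_image box_set_def .
qed

lemma upper_hull_filters_avoiding:
  "upper_hull ` {F. lattice_filter F \<and> a \<notin> F} = diamond_set (minus_set a)"
proof -
  have "upper_hull ` {F. lattice_filter F \<and> a \<notin> F}
      = {C \<in> upper_hull ` {F. lattice_filter F}. C \<inter> minus_set a \<noteq> {}}"
    using upper_hull_disjoint_iff by blast
  then show ?thesis unfolding upper_hull_image diamond_set_def .
qed

text \<open>The composite of the two bijections; this one map serves all three hyperspace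
  topologies.\<close>

definition trace_hull :: "'a::{distrib_lattice,bounded_lattice} free_box set \<Rightarrow> 'a set set" where
  "trace_hull x = upper_hull (box_trace x)"

lemma trace_hull_image: "trace_hull ` A = upper_hull ` box_trace ` A"
  by (simp add: image_image trace_hull_def)

lemma trace_hull_images:
  "trace_hull ` {x. prime_filter x} = hyper_minus"
  "trace_hull ` plus_set (box_gen a) = box_set (minus_set a)"
  "trace_hull ` minus_set (box_gen a) = diamond_set (minus_set a)"
  by (simp_all add: trace_hull_image box_trace_image box_trace_plus_set box_trace_minus_set
      upper_hull_image upper_hull_filters_containing upper_hull_filters_avoiding)

lemma trace_hull_antimono_iff:
  "prime_filter x \<Longrightarrow> prime_filter y \<Longrightarrow> trace_hull y \<subseteq> trace_hull x \<longleftrightarrow> x \<subseteq> y"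
  by (simp add: trace_hull_def upper_hull_mono_iff lattice_filter_box_trace box_trace_mono_iff)

lemma inj_on_box_trace: "inj_on box_trace {x. prime_filter x}"
  by (rule inj_onI) (simp add: set_eq_subset box_trace_mono_iff)

lemma inj_on_trace_hull: "inj_on trace_hull {x. prime_filter x}"
  by (rule inj_onI) (simp add: set_eq_subset trace_hull_antimono_iff)

section \<open>The four homeomorphisms\<close>

lemma order_homeomorphism_box_trace: "order_homeomorphism priestley_space filter_space box_trace"
  unfolding order_homeomorphism_def topspace_priestley_space
proof
  show "homeomorphic_map priestley_space filter_space box_trace"
    unfolding priestley_space_free_box filter_space_def
  proof (rule homeomorphic_map_generated)
    show "inj_on box_trace (\<Union>(range (\<lambda>a. plus_set (box_gen a)) \<union> range (\<lambda>a. minus_set (box_gen a))))"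
      by (rule inj_on_subset[OF inj_on_box_trace]) (auto simp: plus_set_def minus_set_def)
  qed (simp add: image_Un image_image box_trace_plus_set box_trace_minus_set)
qed (simp add: box_trace_mono_iff)

lemma dual_order_homeomorphism_trace_hull:
  "dual_order_homeomorphism priestley_space hyper_diamond_box trace_hull"
  unfolding dual_order_homeomorphism_def topspace_priestley_space
proof
  show "homeomorphic_map priestley_space hyper_diamond_box trace_hull"
    unfolding priestley_space_free_box hyper_diamond_box_eq
  proof (rule homeomorphic_map_generated)
    show "inj_on trace_hull (\<Union>(range (\<lambda>a. plus_set (box_gen a)) \<union> range (\<lambda>a. minus_set (box_gen a))))"
      by (rule inj_on_subset[OF inj_on_trace_hull]) (auto simp: plus_set_def minus_set_def)
  qed (simp add: image_Un image_image trace_hull_images)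
qed (simp add: trace_hull_antimono_iff)

lemma homeomorphic_map_trace_hull_plus: "homeomorphic_map priestley_plus hyper_box trace_hull"
  unfolding priestley_plus_free_box hyper_box_eq
proof (rule homeomorphic_map_generated)
  show "inj_on trace_hull (\<Union>(range (\<lambda>a. plus_set (box_gen a))))"
    by (rule inj_on_subset[OF inj_on_trace_hull]) (auto simp: plus_set_def)
qed (simp add: image_image trace_hull_images)

lemma homeomorphic_map_trace_hull_minus: "homeomorphic_map priestley_minus hyper_diamond trace_hull"
  unfolding priestley_minus_free_box hyper_diamond_eq
proof (rule homeomorphic_map_generated)
  show "inj_on trace_hull (\<Union>(insert {x. prime_filter x} (range (\<lambda>a. minus_set (box_gen a)))))"
    by (rule inj_on_subset[OF inj_on_trace_hull]) (auto simp: minus_set_def)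
qed (simp add: image_image trace_hull_images)

theorem theorem3p10:
  shows "order_homeomorphic
           (priestley_space :: 'a::{distrib_lattice,bounded_lattice} free_box set topology)
           (filter_space :: 'a set topology)
       \<and> dually_order_homeomorphic
           (priestley_space :: 'a free_box set topology)
           (hyper_diamond_box :: 'a set set topology)
       \<and> (priestley_plus :: 'a free_box set topology)
           homeomorphic_space (hyper_box :: 'a set set topology)
       \<and> (priestley_minus :: 'a free_box set topology)
           homeomorphic_space (hyper_diamond :: 'a set set topology)"
  unfolding order_homeomorphic_def dually_order_homeomorphic_def
  using order_homeomorphism_box_trace dual_order_homeomorphism_trace_hull
    homeomorphic_map_imp_homeomorphic_space[OF homeomorphic_map_trace_hull_plus]
    homeomorphic_map_imp_homeomorphic_space[OF homeomorphic_map_trace_hull_minus]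
  by blast

end
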